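(* Let $H:[0,1)\to[0,\infty)$ be an increasing function. Then $$\sup_{n\in\mathbb{N}}\sqrt{n}\,A_n(H)<\infty\quad\text{if and only if}\quad \int_0^1 H(t)\,dt<\infty .$$ In particular, one has $$\frac{1}{\sqrt{2}}\int_0^1 H(t)\,dt\;\le\;\sup_{n\in\mathbb{N}}\sqrt{n}\,A_n(H)\;\le\;\sqrt{2}\int_0^1 H(t)\,dt .$$
   Context: "Increasing" means non-decreasing, and $\mathbb{N}=\{1,2,\dots\}$. For $n\in\mathbb{N}$ let $\mathcal{T}_n:=\{\tau=(t_i)_{i=0}^n:\ 0=t_0<t_1<\cdots<t_n=1\}$. For a non-negative measurable function $H$ on $[0,1)$ and $\tau=(t_i)_{i=0}^n\in\mathcal{T}_n$ define $$A(H,\tau):=\left(\sum_{i=1}^n\int_{t_{i-1}}^{t_i}(t_i-t)H^2(t)\,dt\right)^{1/2},\qquad A_n(H):=\inf_{\tau\in\mathcal{T}_n}A(H,\tau),$$ where these quantities, and the integrals and suprema in the claim, take values in $[0,\infty]$. *)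

theory Defs
  imports "HOL-Analysis.Analysis"
begin

definition ennreal_sqrt :: "ennreal \<Rightarrow> ennreal" where
  "ennreal_sqrt x = (if x = \<infinity> then \<infinity> else ennreal (sqrt (enn2real x)))"

(* The nodes t_0, ..., t_n are the values of a sequence at 0, ..., n; its values
   beyond n are unconstrained and never used. *)
definition partitions :: "nat \<Rightarrow> (nat \<Rightarrow> real) set" where
  "partitions n = {\<tau>. \<tau> 0 = 0 \<and> \<tau> n = 1 \<and> strict_mono_on {0..n} \<tau>}"

(* A function on [0,1) is represented by a total function whose values outside [0,1)
   are never used: the half-open intervals of integration all lie in [0,1). *)
definition A_part :: "(real \<Rightarrow> real) \<Rightarrow> nat \<Rightarrow> (nat \<Rightarrow> real) \<Rightarrow> ennreal" where
  "A_part H n \<tau> =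
     ennreal_sqrt (\<Sum>i=1..n. \<integral>\<^sup>+t\<in>{\<tau> (i - 1)..<\<tau> i}. ennreal ((\<tau> i - t) * (H t)\<^sup>2) \<partial>lborel)"

definition A_inf :: "(real \<Rightarrow> real) \<Rightarrow> nat \<Rightarrow> ennreal" where
  "A_inf H n = (INF \<tau>\<in>partitions n. A_part H n \<tau>)"

end

theory Submission
  imports Defs "HOL-Real_Asymp.Real_Asymp"
begin

text \<open>
  Write \<open>I\<close> for the integral of \<open>H\<close> over \<open>[0,1)\<close>.  Monotonicity enters through one comparison in
  each direction.

  \<^bold>\<open>Upper bound.\<close>  As \<open>H\<close> increases, \<open>(b - t) H(t)\<close> is at most the integral of \<open>H\<close> over
  \<open>[t,b)\<close>, so the contribution of a partition interval to \<open>A(H,\<tau>)\<^sup>2\<close> is at most the square of the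
  integral of \<open>H\<close> over that interval (\<open>weighted_integral_le_square\<close>).  Cutting \<open>[0,1]\<close> into \<open>n\<close>
  intervals on which \<open>H\<close> has the same integral \<open>I/n\<close> (\<open>equal_integral_partition\<close>) makes the sum
  of these squares \<open>I\<^sup>2/n\<close>, hence \<open>\<surd>n A\<^sub>n(H) \<le> I\<close>, which is stronger than the claim.

  \<^bold>\<open>Lower bound.\<close>  On \<open>[a,b)\<close> one has \<open>H \<ge> H(a)\<close>, so that interval contributes at least
  \<open>(H(a) (b - a))\<^sup>2 / 2\<close>, and Cauchy-Schwarz bounds the sum of these terms by lower Riemann sums of
  \<open>H\<close>.  An arbitrary partition may however be coarse, with small lower sums.  The remedy is to
  intersect it with the grid \<open>{j/m}\<close>: at most \<open>n + m\<close> pieces arise (\<open>card_overlaps_le\<close>), and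
  the pieces see at least the lower sum \<open>L\<^sub>m\<close> of the grid, whence
  \<open>A(H,\<tau>)\<^sup>2 \<ge> L\<^sub>m\<^sup>2 / (2(n + m))\<close> for every \<open>\<tau>\<close> (\<open>lower_sum_le_A_part\<close>).  For fixed \<open>m\<close> the
  \<open>m\<close> additional pieces are negligible as \<open>n \<rightarrow> \<infinity>\<close>, so the supremum is at least \<open>L\<^sub>m/\<surd>2\<close>.
  Finally \<open>m \<rightarrow> \<infinity>\<close>: shifting the grid by one cell turns upper sums into lower sums, so \<open>L\<^sub>m\<close>
  dominates the integral of \<open>H\<close> over \<open>[0, 1 - 1/m)\<close>, which increases to \<open>I\<close>.

  The equivalence of finiteness follows from the two inequalities.
\<close>

section \<open>Square roots, partitions and measurability\<close>

lemma ennreal_sqrt_mono: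
  assumes "x \<le> y"
  shows "ennreal_sqrt x \<le> ennreal_sqrt y"
proof (cases "y = \<infinity>")
  case False
  then have "y < top" by (simp add: less_top)
  moreover have "x < top" using assms calculation by (rule le_less_trans)
  ultimately show ?thesis
    using assms by (auto simp: ennreal_sqrt_def intro!: ennreal_leI enn2real_mono)
qed (simp add: ennreal_sqrt_def)

lemma ennreal_sqrt_ennreal:
  "0 \<le> x \<Longrightarrow> ennreal_sqrt (ennreal x) = ennreal (sqrt x)"
  by (simp add: ennreal_sqrt_def)

lemma partition_nodes:
  assumes "\<tau> \<in> partitions n" "i \<in> {1..n}"
  shows "\<tau> (i - 1) < \<tau> i" "0 \<le> \<tau> (i - 1)" "\<tau> i \<le> 1"
proof -
  have sm: "strict_mono_on {0..n} \<tau>" "\<tau> 0 = 0" "\<tau> n = 1"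
    using assms(1) by (auto simp: partitions_def)
  show "\<tau> (i - 1) < \<tau> i"
    using assms(2) by (intro strict_mono_onD[OF sm(1)]) auto
  show "0 \<le> \<tau> (i - 1)"
    using strict_mono_on_leD[OF sm(1), of 0 "i - 1"] assms(2) sm(2) by auto
  show "\<tau> i \<le> 1"
    using strict_mono_on_leD[OF sm(1), of i n] assms(2) sm(3) by auto
qed

lemma mono_on_times_indicator_measurable:
  fixes H :: "real \<Rightarrow> real"
  assumes "mono_on {0..<1} H"
  shows "(\<lambda>t. H t * indicator {0..<1} t) \<in> borel_measurable borel"
  using borel_measurable_mono_on_fnc[OF assms]
  by (simp add: borel_measurable_restrict_space_iff mult.commute)

lemma mono_on_measurable_on_subinterval:
  fixes H :: "real \<Rightarrow> real"
  assumes "mono_on {0..<1} H" "0 \<le> a" "b \<le> 1"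
  shows "(\<lambda>t. ennreal (H t) * indicator {a..<b} t) \<in> borel_measurable lborel"
proof -
  have [measurable]: "(\<lambda>t. H t * indicator {0..<1} t) \<in> borel_measurable borel"
    by (rule mono_on_times_indicator_measurable[OF assms(1)])
  have "(\<lambda>t. ennreal (H t * indicator {0..<1} t) * indicator {a..<b} t) \<in> borel_measurable lborel"
    by measurable
  also have "(\<lambda>t. ennreal (H t * indicator {0..<1} t) * indicator {a..<b} t)
      = (\<lambda>t. ennreal (H t) * indicator {a..<b} t)"
    using assms(2,3) by (auto simp: fun_eq_iff indicator_def)
  finally show ?thesis .
qed

section \<open>The upper bound\<close>

text \<open>
  The factor \<open>(b - t) H(t)\<close> is absorbed into the integral of \<open>H\<close> over \<open>[t,b)\<close>, which no longer
  depends on \<open>t\<close> once it is enlarged to \<open>[a,b)\<close>; the remaining factor \<open>H(t)\<close> integrates to the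
  second copy.
\<close>

lemma weighted_integral_le_square:
  fixes H :: "real \<Rightarrow> real"
  assumes nonneg: "\<And>t. t \<in> {0..<1} \<Longrightarrow> 0 \<le> H t" and mono: "mono_on {0..<1} H"
    and ab: "0 \<le> a" "b \<le> 1"
  shows "(\<integral>\<^sup>+t\<in>{a..<b}. ennreal ((b - t) * (H t)\<^sup>2) \<partial>lborel)
      \<le> (\<integral>\<^sup>+t\<in>{a..<b}. ennreal (H t) \<partial>lborel)\<^sup>2"
proof -
  let ?J = "\<integral>\<^sup>+t\<in>{a..<b}. ennreal (H t) \<partial>lborel"
  have tail: "ennreal ((b - t) * H t) \<le> ?J" if t: "t \<in> {a..<b}" for t
  proof -
    have "0 \<le> H t" using t ab by (intro nonneg) auto
    then have "ennreal ((b - t) * H t) = (\<integral>\<^sup>+s. ennreal (H t) * indicator {t..<b} s \<partial>lborel)"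
      using t by (simp add: ennreal_mult nn_integral_cmult_indicator mult.commute)
    also have "\<dots> \<le> ?J"
    proof (rule nn_integral_mono)
      fix s
      have "H t \<le> H s" if "s \<in> {t..<b}"
        using that t ab by (intro mono_onD[OF mono]) auto
      then show "ennreal (H t) * indicator {t..<b} s \<le> ennreal (H s) * indicator {a..<b} s"
        using t by (auto simp: indicator_def intro: ennreal_leI)
    qed
    finally show ?thesis .
  qed
  have "(\<integral>\<^sup>+t\<in>{a..<b}. ennreal ((b - t) * (H t)\<^sup>2) \<partial>lborel)
      \<le> (\<integral>\<^sup>+t. ?J * (ennreal (H t) * indicator {a..<b} t) \<partial>lborel)"
  proof (rule nn_integral_mono)
    fix t
    show "ennreal ((b - t) * (H t)\<^sup>2) * indicator {a..<b} t
        \<le> ?J * (ennreal (H t) * indicator {a..<b} t)"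
    proof (cases "t \<in> {a..<b}")
      case True
      then have "0 \<le> H t" using ab by (intro nonneg) auto
      with True have "ennreal ((b - t) * (H t)\<^sup>2) = ennreal ((b - t) * H t) * ennreal (H t)"
        by (subst ennreal_mult[symmetric]) (auto simp: power2_eq_square mult.assoc)
      then show ?thesis
        using True tail[OF True] by (simp add: mult_right_mono)
    qed simp
  qed
  also have "\<dots> = ?J * ?J"
    by (rule nn_integral_cmult) (rule mono_on_measurable_on_subinterval[OF mono ab])
  finally show ?thesis by (simp add: power2_eq_square)
qed

lemma uniform_partition: "n \<ge> 1 \<Longrightarrow> (\<lambda>i. real i / real n) \<in> partitions n"
  by (auto simp: partitions_def intro!: strict_mono_onI divide_strict_right_mono)

text \<open>
  The nodes are chosen by the intermediate value theorem for the primitive \<open>F(x)\<close>, the integral of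
  \<open>H\<close> over \<open>[0,x)\<close>, which is continuous also where \<open>H\<close> jumps and at \<open>1\<close>, where \<open>H\<close> may be
  unbounded.  The nodes are distinct because their \<open>F\<close>-values are, provided \<open>I > 0\<close>; if \<open>I = 0\<close>,
  every partition will do.
\<close>

lemma equal_integral_partition:
  fixes H :: "real \<Rightarrow> real"
  assumes nonneg: "\<And>t. t \<in> {0..<1} \<Longrightarrow> 0 \<le> H t" and mono: "mono_on {0..<1} H"
    and I: "(\<integral>\<^sup>+t\<in>{0..<1}. ennreal (H t) \<partial>lborel) = ennreal I" "0 \<le> I"
    and n: "n \<ge> 1"
  shows "\<exists>\<tau>\<in>partitions n. \<forall>i\<in>{1..n}.
      (\<integral>\<^sup>+t\<in>{\<tau> (i - 1)..<\<tau> i}. ennreal (H t) \<partial>lborel) \<le> ennreal (I / real n)"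
proof (cases "I = 0")
  case True
  show ?thesis
  proof (intro bexI[OF _ uniform_partition[OF n]] ballI)
    fix i assume i: "i \<in> {1..n}"
    have "(\<integral>\<^sup>+t\<in>{real (i - 1) / real n..<real i / real n}. ennreal (H t) \<partial>lborel)
        \<le> (\<integral>\<^sup>+t\<in>{0..<1}. ennreal (H t) \<partial>lborel)"
    proof (rule nn_integral_mono)
      fix t
      have "real i / real n \<le> 1" using i by simp
      then show "ennreal (H t) * indicator {real (i - 1) / real n..<real i / real n} t
          \<le> ennreal (H t) * indicator {0..<1} t"
        by (auto simp: indicator_def) (meson divide_nonneg_nonneg of_nat_0_le_iff order_trans)
    qed
    then show "(\<integral>\<^sup>+t\<in>{real (i - 1) / real n..<real i / real n}. ennreal (H t) \<partial>lborel)
        \<le> ennreal (I / real n)"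
      using I True by simp
  qed
next
  case False
  then have Ipos: "0 < I" using I(2) by simp
  define f where "f = (\<lambda>t. H t * indicator {0..<1} t)"
  have f_nonneg: "0 \<le> f t" for t
    using nonneg by (auto simp: f_def indicator_def)
  have f_meas [measurable]: "f \<in> borel_measurable borel"
    unfolding f_def by (rule mono_on_times_indicator_measurable[OF mono])
  have f_H: "ennreal (f t) * indicator S t = ennreal (H t) * indicator S t"
    if "S \<subseteq> {0..<1}" for S t
    using that by (auto simp: f_def indicator_def)
  have total: "(\<integral>\<^sup>+t. ennreal (f t) \<partial>lborel) = ennreal I"
    unfolding I(1)[symmetric] by (intro nn_integral_cong) (auto simp: f_def indicator_def)
  have f_int: "integrable lborel f"
    by (rule integrableI_nonneg) (use f_nonneg total in auto)
  have f_set_int: "set_integrable lborel {a..b} f" for a b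
    using f_int unfolding set_integrable_def by (intro integrable_mult_indicator) auto
  have nn_eq: "(\<integral>\<^sup>+t\<in>{a..<b}. ennreal (f t) \<partial>lborel) = ennreal (integral {a..b} f)" for a b
  proof -
    have "(\<integral>\<^sup>+t\<in>{a..<b}. ennreal (f t) \<partial>lborel) = (\<integral>\<^sup>+t. ennreal (indicator {a..b} t *\<^sub>R f t) \<partial>lborel)"
      by (rule nn_integral_cong_AE, rule eventually_mono[OF AE_lborel_singleton[of b]])
         (auto simp: indicator_def)
    also have "\<dots> = ennreal (LINT t:{a..b}|lborel. f t)"
      unfolding set_lebesgue_integral_def
      by (rule nn_integral_eq_integral)
         (use f_set_int f_nonneg in \<open>auto simp: set_integrable_def\<close>)
    finally show ?thesis by (simp add: set_borel_integral_eq_integral[OF f_set_int])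
  qed
  define F where "F = (\<lambda>x. integral {0..x} f)"
  have f_intble: "f integrable_on {a..b}" for a b
    by (rule set_borel_integral_eq_integral(1)[OF f_set_int])
  have F_cont: "continuous_on {0..1} F"
    unfolding F_def by (rule indefinite_integral_continuous_1[OF f_intble])
  have F0: "F 0 = 0" by (simp add: F_def)
  have "ennreal (F 1) = ennreal I"
    unfolding F_def nn_eq[symmetric] by (subst f_H) (use I in auto)
  moreover have "0 \<le> F 1" unfolding F_def by (intro integral_nonneg f_intble f_nonneg)
  ultimately have F1: "F 1 = I" using I(2) by simp
  have F_diff: "F y - F x = integral {x..y} f" if "0 \<le> x" "x \<le> y" for x y
    using Henstock_Kurzweil_Integration.integral_combine[OF that f_intble] by (simp add: F_def)
  have F_mono: "F x \<le> F y" if "0 \<le> x" "x \<le> y" for x y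
    using F_diff[OF that] integral_nonneg[OF f_intble, of x y] f_nonneg by simp
  have "\<exists>x. 0 \<le> x \<and> x \<le> 1 \<and> F x = real i * I / real n" if "i \<le> n" for i
  proof (rule IVT')
    show "F 0 \<le> real i * I / real n" using F0 Ipos by simp
    show "real i * I / real n \<le> F 1"
      using that n Ipos by (simp add: F1 field_simps)
  qed (use F_cont in auto)
  then obtain x where x: "\<And>i. i \<le> n \<Longrightarrow> 0 \<le> x i \<and> x i \<le> 1 \<and> F (x i) = real i * I / real n"
    by metis
  \<comment> \<open>The end nodes are set by hand, since the points \<open>x 0\<close> and \<open>x n\<close> need not be \<open>0\<close> and \<open>1\<close>:
    for instance, \<open>F = 0\<close> on a whole interval when \<open>H\<close> vanishes near \<open>0\<close>.\<close>
  define \<tau> where "\<tau> = (\<lambda>i. if i = 0 then 0 else if i = n then 1 else x i)"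
  have \<tau>: "0 \<le> \<tau> i" "\<tau> i \<le> 1" "F (\<tau> i) = real i * I / real n" if "i \<le> n" for i
    using x[OF that] F0 F1 n by (auto simp: \<tau>_def)
  have \<tau>_less: "\<tau> i < \<tau> j" if "i < j" "j \<le> n" for i j
  proof (rule ccontr)
    assume "\<not> \<tau> i < \<tau> j"
    then have "F (\<tau> j) \<le> F (\<tau> i)" using \<tau>[of j] that by (intro F_mono) auto
    then have "real j * I \<le> real i * I" using \<tau>(3)[of i] \<tau>(3)[of j] that n
      by (simp add: divide_le_cancel)
    then show False using Ipos that by simp
  qed
  have part: "\<tau> \<in> partitions n"
    unfolding partitions_def using n
    by (auto intro!: strict_mono_onI \<tau>_less) (auto simp: \<tau>_def)
  show ?thesis
  proof (intro bexI[OF _ part] ballI)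
    fix i assume i: "i \<in> {1..n}"
    note nodes = partition_nodes[OF part i]
    have "(\<integral>\<^sup>+t\<in>{\<tau> (i - 1)..<\<tau> i}. ennreal (H t) \<partial>lborel) = ennreal (F (\<tau> i) - F (\<tau> (i - 1)))"
      using nodes by (subst f_H[symmetric]) (auto simp: nn_eq F_diff)
    also have "F (\<tau> i) - F (\<tau> (i - 1)) = I / real n"
    proof -
      have "F (\<tau> i) - F (\<tau> (i - 1)) = (real i - real (i - 1)) * I / real n"
        using \<tau>(3)[of i] \<tau>(3)[of "i - 1"] i n
        by (auto simp: diff_divide_distrib left_diff_distrib simp del: of_nat_diff)
      also have "real i - real (i - 1) = 1" using i by (simp add: of_nat_diff)
      finally show ?thesis by simp
    qed
    finally show "(\<integral>\<^sup>+t\<in>{\<tau> (i - 1)..<\<tau> i}. ennreal (H t) \<partial>lborel) \<le> ennreal (I / real n)"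
      by simp
  qed
qed

lemma scaled_A_inf_le_integral:
  fixes H :: "real \<Rightarrow> real"
  assumes nonneg: "\<And>t. t \<in> {0..<1} \<Longrightarrow> 0 \<le> H t" and mono: "mono_on {0..<1} H"
    and n: "n \<ge> 1"
  shows "ennreal (sqrt (real n)) * A_inf H n \<le> (\<integral>\<^sup>+t\<in>{0..<1}. ennreal (H t) \<partial>lborel)"
proof (cases "\<integral>\<^sup>+t\<in>{0..<1}. ennreal (H t) \<partial>lborel")
  case top
  then show ?thesis by simp
next
  case (real I)
  obtain \<tau> where \<tau>: "\<tau> \<in> partitions n" "\<And>i. i \<in> {1..n} \<Longrightarrow>
      (\<integral>\<^sup>+t\<in>{\<tau> (i - 1)..<\<tau> i}. ennreal (H t) \<partial>lborel) \<le> ennreal (I / real n)"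
    using equal_integral_partition[OF nonneg mono real(2,1) n] by metis
  have "(\<Sum>i=1..n. \<integral>\<^sup>+t\<in>{\<tau> (i - 1)..<\<tau> i}. ennreal ((\<tau> i - t) * (H t)\<^sup>2) \<partial>lborel)
      \<le> (\<Sum>i=1..n. (ennreal (I / real n))\<^sup>2)"
  proof (rule sum_mono)
    fix i assume i: "i \<in> {1..n}"
    show "(\<integral>\<^sup>+t\<in>{\<tau> (i - 1)..<\<tau> i}. ennreal ((\<tau> i - t) * (H t)\<^sup>2) \<partial>lborel)
        \<le> (ennreal (I / real n))\<^sup>2"
      using weighted_integral_le_square[OF nonneg mono partition_nodes(2,3)[OF \<tau>(1) i]]
        power_mono[OF \<tau>(2)[OF i] zero_le, of 2] by (rule order_trans)
  qed
  also have "\<dots> = ennreal (real n) * ennreal ((I / real n)\<^sup>2)"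
    using real by (simp add: ennreal_power ennreal_of_nat_eq_real_of_nat)
  also have "\<dots> = ennreal (I\<^sup>2 / real n)"
    using n by (simp add: ennreal_mult[symmetric] power2_eq_square)
  finally have "A_part H n \<tau> \<le> ennreal (sqrt (I\<^sup>2 / real n))"
    unfolding A_part_def using ennreal_sqrt_mono ennreal_sqrt_ennreal[of "I\<^sup>2 / real n"] by fastforce
  also have "sqrt (I\<^sup>2 / real n) = I / sqrt (real n)"
    using real by (simp add: real_sqrt_divide)
  finally have "A_inf H n \<le> ennreal (I / sqrt (real n))"
    unfolding A_inf_def using \<tau>(1) by (meson INF_lower2)
  then have "ennreal (sqrt (real n)) * A_inf H n \<le> ennreal (sqrt (real n)) * ennreal (I / sqrt (real n))"
    by (rule mult_left_mono) simp
  also have "\<dots> = ennreal I"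
    using real n by (subst ennreal_mult[symmetric]) auto
  finally show ?thesis using real by simp
qed

section \<open>The lower bound\<close>

definition clip :: "real \<Rightarrow> real \<Rightarrow> real \<Rightarrow> real" where
  "clip x y s = max x (min y s)"

text \<open>
  \<open>overlap m j a b\<close> is, for \<open>a \<le> b\<close>, the length of the intersection of \<open>[a,b)\<close> with the
  grid cell \<open>[j/m, (j+1)/m)\<close>.  Expressing it as a difference of clipped end points makes its sum over the
  intervals of a partition telescope.
\<close>

definition overlap :: "nat \<Rightarrow> nat \<Rightarrow> real \<Rightarrow> real \<Rightarrow> real" where
  "overlap m j a b =
     clip (real j / real m) (real (Suc j) / real m) b - clip (real j / real m) (real (Suc j) / real m) a"

lemma nn_integral_remaining_length:
  fixes p q :: real
  assumes "p \<le> q"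
  shows "(\<integral>\<^sup>+t\<in>{p..<q}. ennreal (q - t) \<partial>lborel) = ennreal ((q - p)\<^sup>2 / 2)"
proof -
  have "(\<integral>\<^sup>+t\<in>{p..<q}. ennreal (q - t) \<partial>lborel) = (\<integral>\<^sup>+t\<in>{p..q}. ennreal (q - t) \<partial>lborel)"
    by (intro nn_integral_cong) (auto simp: indicator_def)
  also have "\<dots> = ennreal (- ((q - q)\<^sup>2 / 2) - - ((q - p)\<^sup>2 / 2))"
    by (rule nn_integral_FTC_Icc) (use assms in \<open>auto intro!: derivative_eq_intros simp: field_simps\<close>)
  finally show ?thesis by simp
qed

lemma grid_cell_unique:
  assumes "m \<ge> 1" "real j / real m \<le> t" "t < real (Suc j) / real m"
  shows "j = nat \<lfloor>real m * t\<rfloor>"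
proof -
  have "real j \<le> real m * t" "real m * t < real j + 1"
    using assms by (auto simp: field_simps)
  then have "\<lfloor>real m * t\<rfloor> = int j" by (intro floor_unique) auto
  then show ?thesis by simp
qed

text \<open>
  On the piece \<open>[p,q)\<close> cut out of \<open>[a,b)\<close> by the \<open>j\<close>-th cell, the integrand is at least
  \<open>(q - t) H(j/m)\<^sup>2\<close>, whose integral is \<open>H(j/m)\<^sup>2 (q - p)\<^sup>2 / 2\<close>.  The pieces are disjoint, so at each
  \<open>t\<close> at most one summand is nonzero.
\<close>

lemma sum_squares_le_weighted_integral:
  fixes H :: "real \<Rightarrow> real"
  assumes nonneg: "\<And>t. t \<in> {0..<1} \<Longrightarrow> 0 \<le> H t" and mono: "mono_on {0..<1} H"
    and ab: "0 \<le> a" "a \<le> b" "b \<le> 1" and m: "m \<ge> 1"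
  shows "(\<Sum>j<m. ennreal ((H (real j / real m) * overlap m j a b)\<^sup>2 / 2))
      \<le> (\<integral>\<^sup>+t\<in>{a..<b}. ennreal ((b - t) * (H t)\<^sup>2) \<partial>lborel)"
proof -
  define p where "p j = clip (real j / real m) (real (Suc j) / real m) a" for j
  define q where "q j = clip (real j / real m) (real (Suc j) / real m) b" for j
  have grid: "real j / real m \<le> real (Suc j) / real m" for j
    by (intro divide_right_mono) auto
  have pq: "p j \<le> q j" for j
    using ab by (auto simp: p_def q_def clip_def)
  have piece: "a \<le> t" "t < q j" "q j \<le> b" "real j / real m \<le> t" "t < real (Suc j) / real m"
    if "t \<in> {p j..<q j}" for j t
    using that ab grid[of j] by (auto simp: p_def q_def clip_def max_def min_def split: if_splits)
  have "(\<Sum>j<m. ennreal ((H (real j / real m) * overlap m j a b)\<^sup>2 / 2))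
      = (\<Sum>j<m. \<integral>\<^sup>+t. ennreal ((H (real j / real m))\<^sup>2) * (ennreal (q j - t) * indicator {p j..<q j} t) \<partial>lborel)"
    by (intro sum.cong refl, subst nn_integral_cmult)
       (simp_all add: nn_integral_remaining_length[OF pq] ennreal_mult[symmetric] power_mult_distrib
         overlap_def flip: p_def q_def del: of_nat_Suc)
  also have "\<dots> = (\<integral>\<^sup>+t. (\<Sum>j<m. ennreal ((H (real j / real m))\<^sup>2) * (ennreal (q j - t) * indicator {p j..<q j} t)) \<partial>lborel)"
    by (rule nn_integral_sum[symmetric]) measurable
  also have "\<dots> \<le> (\<integral>\<^sup>+t\<in>{a..<b}. ennreal ((b - t) * (H t)\<^sup>2) \<partial>lborel)"
  proof (rule nn_integral_mono)
    fix t
    show "(\<Sum>j<m. ennreal ((H (real j / real m))\<^sup>2) * (ennreal (q j - t) * indicator {p j..<q j} t))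
        \<le> ennreal ((b - t) * (H t)\<^sup>2) * indicator {a..<b} t" (is "sum ?g _ \<le> ?r")
    proof (cases "\<exists>k<m. t \<in> {p k..<q k}")
      case True
      then obtain k where k: "k < m" "t \<in> {p k..<q k}" by blast
      have "?g j = 0" if "j \<noteq> k" for j
        using that piece(4,5)[of t j] piece(4,5)[OF k(2)] grid_cell_unique[OF m]
        by (metis indicator_simps(2) mult_zero_right)
      then have "sum ?g {..<m} = sum ?g {k}"
        using k by (intro sum.mono_neutral_right) auto
      also have "\<dots> = ennreal ((H (real k / real m))\<^sup>2 * (q k - t))"
        using k by (simp add: ennreal_mult)
      also have "\<dots> \<le> ennreal ((b - t) * (H t)\<^sup>2)"
      proof -
        have "t < 1" using piece[OF k(2)] ab by linarith
        moreover have "0 \<le> real k / real m" "0 \<le> t" using piece(1)[OF k(2)] ab by auto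
        ultimately have "0 \<le> H (real k / real m)" "H (real k / real m) \<le> H t"
          using piece(4)[OF k(2)] by (auto intro!: nonneg mono_onD[OF mono])
        then have "(H (real k / real m))\<^sup>2 * (q k - t) \<le> (H t)\<^sup>2 * (b - t)"
          using piece[OF k(2)] by (intro mult_mono power_mono) auto
        then show ?thesis by (intro ennreal_leI) (simp add: mult.commute)
      qed
      finally show ?thesis using piece[OF k(2)] by simp
    next
      case False
      then have "?g j = 0" if "j < m" for j using that by auto
      then have "sum ?g {..<m} = 0" by (intro sum.neutral) auto
      then show ?thesis by (simp only: zero_le)
    qed
  qed
  finally show ?thesis .
qed

text \<open>
  The pieces are ordered from left to right, and in passing from one to the next neither index
  decreases; hence \<open>i + j\<close> takes different values on different pieces.
\<close>

lemma card_overlaps_le: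
  assumes \<tau>: "\<tau> \<in> partitions n" and m: "m \<ge> 1"
  shows "card {(i, j). i \<in> {1..n} \<and> j < m \<and> overlap m j (\<tau> (i - 1)) (\<tau> i) \<noteq> 0} \<le> n + m"
    (is "card ?P \<le> _")
proof -
  have sm: "strict_mono_on {0..n} \<tau>" using \<tau> by (auto simp: partitions_def)
  have meet: "\<tau> (i - 1) < real (Suc j) / real m" "real j / real m < \<tau> i" if "(i, j) \<in> ?P" for i j
  proof -
    have "\<tau> (i - 1) < \<tau> i" using that by (intro partition_nodes(1)[OF \<tau>]) auto
    moreover have "real j / real m < real (Suc j) / real m" using m by (intro divide_strict_right_mono) auto
    ultimately show "\<tau> (i - 1) < real (Suc j) / real m" "real j / real m < \<tau> i"
      using that by (auto simp: overlap_def clip_def max_def min_def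
          simp del: of_nat_Suc split: if_splits)
  qed
  have no_swap: False
    if P: "(i, j) \<in> ?P" "(i', j') \<in> ?P" and less: "i < i'" "j' < j" for i j i' j'
  proof -
    have "\<tau> i \<le> \<tau> (i' - 1)"
      by (rule strict_mono_on_leD[OF sm]) (use P less in auto)
    also have "\<dots> < real (Suc j') / real m" by (rule meet(1)[OF P(2)])
    also have "\<dots> \<le> real j / real m" using less by (intro divide_right_mono) auto
    also have "\<dots> < \<tau> i" by (rule meet(2)[OF P(1)])
    finally show False .
  qed
  have "inj_on (\<lambda>(i, j). i + j) ?P"
  proof (rule inj_onI, clarify)
    fix i j i' j'
    assume 1: "i \<in> {1..n}" "j < m" "overlap m j (\<tau> (i - 1)) (\<tau> i) \<noteq> 0"
      and 2: "i' \<in> {1..n}" "j' < m" "overlap m j' (\<tau> (i' - 1)) (\<tau> i') \<noteq> 0"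
      and eq: "i + j = i' + j'"
    have "\<not> (i < i' \<and> j' < j)" using no_swap[of i j i' j'] 1 2 by blast
    moreover have "\<not> (i' < i \<and> j < j')" using no_swap[of i' j' i j] 1 2 by blast
    ultimately show "i = i' \<and> j = j'" using eq by linarith
  qed
  moreover have "(\<lambda>(i, j). i + j) ` ?P \<subseteq> {1..n + m}" by auto
  ultimately have "card ?P \<le> card {1..n + m}"
    by (rule card_inj_on_le) simp
  then show ?thesis by simp
qed

lemma sum_overlap_eq_cell_length:
  assumes \<tau>: "\<tau> \<in> partitions n" and j: "j < m"
  shows "(\<Sum>i=1..n. overlap m j (\<tau> (i - 1)) (\<tau> i)) = 1 / real m"
proof -
  have ends: "\<tau> 0 = 0" "\<tau> n = 1" using \<tau> by (auto simp: partitions_def)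
  have bounds: "real (Suc j) / real m \<le> 1" "0 \<le> real j / real m"
      "0 < real (Suc j) / real m" "real j / real m \<le> real (Suc j) / real m"
    using j by (auto intro: divide_right_mono)
  let ?c = "clip (real j / real m) (real (Suc j) / real m)"
  have "(\<Sum>i=1..n. overlap m j (\<tau> (i - 1)) (\<tau> i)) = ?c (\<tau> n) - ?c (\<tau> 0)"
    using sum_telescope''[of 0 n "\<lambda>i. ?c (\<tau> i)"] by (simp add: overlap_def)
  also have "\<dots> = real (Suc j) / real m - real j / real m"
    using bounds unfolding ends clip_def by linarith
  finally show ?thesis by (simp add: diff_divide_distrib[symmetric])
qed

definition lower_sum :: "(real \<Rightarrow> real) \<Rightarrow> nat \<Rightarrow> real" where
  "lower_sum H m = (\<Sum>j<m. H (real j / real m) / real m)"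

text \<open>
  The sum of \<open>H(j/m)\<close> times the overlap over all pieces is \<open>L\<^sub>m\<close>.  Cauchy-Schwarz over the nonempty
  pieces only, of which there are at most \<open>n + m\<close> rather than \<open>n m\<close>, compares its square with the
  sum of squares that bounds \<open>A(H,\<tau>)\<^sup>2\<close> from below.
\<close>

lemma lower_sum_le_A_part:
  fixes H :: "real \<Rightarrow> real"
  assumes nonneg: "\<And>t. t \<in> {0..<1} \<Longrightarrow> 0 \<le> H t" and mono: "mono_on {0..<1} H"
    and \<tau>: "\<tau> \<in> partitions n" and m: "m \<ge> 1"
  shows "ennreal (lower_sum H m / sqrt (2 * real (n + m))) \<le> A_part H n \<tau>"
proof -
  define g where "g = (\<lambda>(i, j). H (real j / real m) * overlap m j (\<tau> (i - 1)) (\<tau> i))"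
  define P where "P = {(i, j). i \<in> {1..n} \<and> j < m \<and> overlap m j (\<tau> (i - 1)) (\<tau> i) \<noteq> 0}"
  have fin: "finite ({1..n} \<times> {..<m})" by simp
  have P_sub: "P \<subseteq> {1..n} \<times> {..<m}" by (auto simp: P_def)
  have off_P: "g z = 0" if "z \<in> {1..n} \<times> {..<m} - P" for z
    using that by (auto simp: P_def g_def)
  have L_nonneg: "0 \<le> lower_sum H m"
    unfolding lower_sum_def using m by (intro sum_nonneg divide_nonneg_nonneg nonneg) auto
  have "lower_sum H m = (\<Sum>j<m. H (real j / real m) * (\<Sum>i=1..n. overlap m j (\<tau> (i - 1)) (\<tau> i)))"
    unfolding lower_sum_def by (intro sum.cong refl) (simp add: sum_overlap_eq_cell_length[OF \<tau>] del: One_nat_def)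
  also have "\<dots> = (\<Sum>i=1..n. \<Sum>j<m. g (i, j))"
    by (subst sum.swap) (simp add: g_def sum_distrib_left)
  also have "\<dots> = sum g ({1..n} \<times> {..<m})" by (simp add: sum.cartesian_product)
  also have "\<dots> = sum g P"
    by (rule sum.mono_neutral_right[OF fin P_sub]) (use off_P in blast)
  finally have "(lower_sum H m)\<^sup>2 \<le> (\<Sum>z\<in>P. (g z)\<^sup>2) * real (card P)"
    using sum_squared_le_sum_of_squares[of g P] by simp
  also have "\<dots> \<le> (\<Sum>z\<in>P. (g z)\<^sup>2) * real (n + m)"
    using card_overlaps_le[OF \<tau> m] by (intro mult_left_mono sum_nonneg) (auto simp: P_def)
  also have "(\<Sum>z\<in>P. (g z)\<^sup>2) = (\<Sum>z\<in>{1..n} \<times> {..<m}. (g z)\<^sup>2)"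
    by (rule sum.mono_neutral_left[OF fin P_sub]) (use off_P in auto)
  finally have CS: "(lower_sum H m)\<^sup>2 / (2 * real (n + m)) \<le> (\<Sum>z\<in>{1..n} \<times> {..<m}. (g z)\<^sup>2 / 2)"
    using m by (simp add: sum_divide_distrib[symmetric] field_simps)
  have "ennreal ((lower_sum H m)\<^sup>2 / (2 * real (n + m))) \<le> ennreal (\<Sum>z\<in>{1..n} \<times> {..<m}. (g z)\<^sup>2 / 2)"
    by (rule ennreal_leI[OF CS])
  also have "\<dots> = (\<Sum>i=1..n. \<Sum>j<m. ennreal ((g (i, j))\<^sup>2 / 2))"
    by (subst sum_ennreal[symmetric]) (auto simp: sum.cartesian_product case_prod_beta simp del: sum_ennreal)
  also have "\<dots> \<le> (\<Sum>i=1..n. \<integral>\<^sup>+t\<in>{\<tau> (i - 1)..<\<tau> i}. ennreal ((\<tau> i - t) * (H t)\<^sup>2) \<partial>lborel)"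
  proof (rule sum_mono)
    fix i assume "i \<in> {1..n}"
    note nodes = partition_nodes[OF \<tau> this]
    show "(\<Sum>j<m. ennreal ((g (i, j))\<^sup>2 / 2))
        \<le> (\<integral>\<^sup>+t\<in>{\<tau> (i - 1)..<\<tau> i}. ennreal ((\<tau> i - t) * (H t)\<^sup>2) \<partial>lborel)"
      unfolding g_def prod.case
      by (rule sum_squares_le_weighted_integral[OF nonneg mono]) (use nodes m in auto)
  qed
  finally have "ennreal_sqrt (ennreal ((lower_sum H m)\<^sup>2 / (2 * real (n + m)))) \<le> A_part H n \<tau>"
    unfolding A_part_def by (rule ennreal_sqrt_mono)
  then show ?thesis
    using L_nonneg by (simp add: ennreal_sqrt_ennreal real_sqrt_divide)
qed

text \<open>
  The factor \<open>\<surd>(n / (2(n + m)))\<close> left over from the previous bound tends to \<open>1/\<surd>2\<close> as \<open>n\<close> grows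
  with \<open>m\<close> fixed.
\<close>

lemma lower_sum_le_SUP:
  fixes H :: "real \<Rightarrow> real"
  assumes nonneg: "\<And>t. t \<in> {0..<1} \<Longrightarrow> 0 \<le> H t" and mono: "mono_on {0..<1} H"
    and m: "m \<ge> 1"
  shows "ennreal (lower_sum H m / sqrt 2) \<le> (SUP n\<in>{1::nat..}. ennreal (sqrt (real n)) * A_inf H n)"
    (is "_ \<le> ?S")
proof -
  let ?L = "lower_sum H m"
  have L_nonneg: "0 \<le> ?L"
    unfolding lower_sum_def using m by (intro sum_nonneg divide_nonneg_nonneg nonneg) auto
  have le: "ennreal (sqrt (real n / (2 * real (n + m))) * ?L) \<le> ?S" if n: "n \<ge> 1" for n
  proof -
    have "ennreal (?L / sqrt (2 * real (n + m))) \<le> A_inf H n"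
      unfolding A_inf_def by (intro INF_greatest lower_sum_le_A_part[OF nonneg mono _ m])
    then have "ennreal (sqrt (real n)) * ennreal (?L / sqrt (2 * real (n + m)))
        \<le> ennreal (sqrt (real n)) * A_inf H n"
      by (rule mult_left_mono) simp
    also have "\<dots> \<le> ?S" using n by (intro SUP_upper) auto
    finally show ?thesis
      using L_nonneg by (subst (asm) ennreal_mult[symmetric]) (auto simp: real_sqrt_divide)
  qed
  have "(\<lambda>n. real n / (2 * real (n + m))) \<longlonglongrightarrow> 1 / 2"
  proof -
    have "(\<lambda>n. real n / (real n + real m)) \<longlonglongrightarrow> 1"
      by real_asymp
    then have "(\<lambda>n. real n / (real n + real m) / 2) \<longlonglongrightarrow> 1 / 2"
      by (intro tendsto_intros) auto
    then show ?thesis by (simp add: mult.commute)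
  qed
  then have "(\<lambda>n. ennreal (sqrt (real n / (2 * real (n + m))) * ?L)) \<longlonglongrightarrow> ennreal (sqrt (1 / 2) * ?L)"
    by (intro tendsto_ennrealI tendsto_mult tendsto_real_sqrt tendsto_const)
  then have "ennreal (sqrt (1 / 2) * ?L) \<le> ?S"
    by (rule LIMSEQ_le_const2) (use le in blast)
  then show ?thesis by (simp add: real_sqrt_divide)
qed

text \<open>
  On the cell \<open>[(j-1)/m, j/m)\<close> the function is at most its value at the right end point \<open>j/m\<close>, which
  is the left end point of the next cell and occurs as such in the lower sum.  The last cell has to
  be left out, as \<open>H\<close> may be unbounded there.
\<close>

lemma truncated_integral_le_lower_sum:
  fixes H :: "real \<Rightarrow> real"
  assumes nonneg: "\<And>t. t \<in> {0..<1} \<Longrightarrow> 0 \<le> H t" and mono: "mono_on {0..<1} H"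
    and m: "m \<ge> 1"
  shows "(\<integral>\<^sup>+t\<in>{0..<1 - 1 / real m}. ennreal (H t) \<partial>lborel) \<le> ennreal (lower_sum H m)"
proof -
  let ?cell = "\<lambda>j. {real (j - 1) / real m..<real j / real m}"
  have H_nonneg: "0 \<le> H (real j / real m)" if "j < m" for j
    using that by (intro nonneg) auto
  have "(\<integral>\<^sup>+t\<in>{0..<1 - 1 / real m}. ennreal (H t) \<partial>lborel)
      \<le> (\<integral>\<^sup>+t. (\<Sum>j\<in>{1..<m}. ennreal (H (real j / real m)) * indicator (?cell j) t) \<partial>lborel)"
  proof (rule nn_integral_mono)
    fix t
    show "ennreal (H t) * indicator {0..<1 - 1 / real m} t
        \<le> (\<Sum>j\<in>{1..<m}. ennreal (H (real j / real m)) * indicator (?cell j) t)" (is "_ \<le> sum ?g _")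
    proof (cases "t \<in> {0..<1 - 1 / real m}")
      case True
      \<comment> \<open>the index of the right end point of the cell that contains \<open>t\<close>\<close>
      define k where "k = Suc (nat \<lfloor>real m * t\<rfloor>)"
      have "real (k - 1) \<le> real m * t" "real m * t < real k"
        using True m by (auto simp: k_def) linarith+
      moreover have "real m * t < real m - 1"
        using True m by (simp add: field_simps)
      ultimately have k: "k \<in> {1..<m}" "t \<in> ?cell k"
        using m by (auto simp: k_def field_simps)
      moreover have "t < 1"
      proof -
        have "1 - 1 / real m \<le> 1" by simp
        then show ?thesis using True by (meson atLeastLessThan_iff less_le_trans)
      qed
      ultimately have "H t \<le> H (real k / real m)"
        using True by (intro mono_onD[OF mono]) auto
      then have "ennreal (H t) * indicator {0..<1 - 1 / real m} t \<le> ?g k"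
        using True k by (simp add: ennreal_leI)
      also have "\<dots> \<le> sum ?g {1..<m}"
        using k by (intro member_le_sum) auto
      finally show ?thesis .
    qed simp
  qed
  also have "\<dots> = (\<Sum>j\<in>{1..<m}. \<integral>\<^sup>+t. ennreal (H (real j / real m)) * indicator (?cell j) t \<partial>lborel)"
    by (rule nn_integral_sum) measurable
  also have "\<dots> = (\<Sum>j\<in>{1..<m}. ennreal (H (real j / real m) / real m))"
  proof (rule sum.cong[OF refl])
    fix j assume j: "j \<in> {1..<m}"
    have "emeasure lborel (?cell j) = ennreal (real j / real m - real (j - 1) / real m)"
      by (rule emeasure_lborel_Ico) (auto intro: divide_right_mono)
    also have "real j / real m - real (j - 1) / real m = 1 / real m"
      using j by (simp add: diff_divide_distrib[symmetric] of_nat_diff)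
    finally show "(\<integral>\<^sup>+t. ennreal (H (real j / real m)) * indicator (?cell j) t \<partial>lborel)
        = ennreal (H (real j / real m) / real m)"
      using j H_nonneg by (simp add: nn_integral_cmult_indicator ennreal_mult[symmetric])
  qed
  also have "\<dots> = ennreal (\<Sum>j\<in>{1..<m}. H (real j / real m) / real m)"
    using H_nonneg by (intro sum_ennreal) auto
  also have "\<dots> \<le> ennreal (lower_sum H m)"
    unfolding lower_sum_def using H_nonneg by (intro ennreal_leI sum_mono2) auto
  finally show ?thesis .
qed

lemma integral_eq_SUP_truncated:
  fixes H :: "real \<Rightarrow> real"
  assumes "mono_on {0..<1} H"
  shows "(\<integral>\<^sup>+t\<in>{0..<1}. ennreal (H t) \<partial>lborel)
      = (SUP k. \<integral>\<^sup>+t\<in>{0..<1 - 1 / real (Suc k)}. ennreal (H t) \<partial>lborel)"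
proof -
  let ?f = "\<lambda>k t. ennreal (H t) * indicator {0..<1 - 1 / real (Suc k)} t"
  have bound_mono: "1 - 1 / real (Suc k) \<le> 1 - 1 / real (Suc l)" if "k \<le> l" for k l
    using that by (simp add: frac_le)
  have "(SUP k. ?f k t) = ennreal (H t) * indicator {0..<1} t" for t
  proof (rule antisym)
    show "(SUP k. ?f k t) \<le> ennreal (H t) * indicator {0..<1} t"
    proof (rule SUP_least)
      fix k
      have "0 < 1 / real (Suc k)" by simp
      then have "t < 1" if "t < 1 - 1 / real (Suc k)" using that by linarith
      then show "?f k t \<le> ennreal (H t) * indicator {0..<1} t"
        by (auto simp: indicator_def simp del: of_nat_Suc)
    qed
    show "ennreal (H t) * indicator {0..<1} t \<le> (SUP k. ?f k t)"
    proof (cases "t \<in> {0..<1}")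
      case True
      then obtain k where "inverse (real (Suc k)) < 1 - t"
        using reals_Archimedean[of "1 - t"] by auto
      then have "ennreal (H t) * indicator {0..<1} t = ?f k t"
        using True by (simp add: inverse_eq_divide)
      also have "\<dots> \<le> (SUP k. ?f k t)" by (rule SUP_upper) simp
      finally show ?thesis .
    qed simp
  qed
  then have "(\<integral>\<^sup>+t\<in>{0..<1}. ennreal (H t) \<partial>lborel) = (\<integral>\<^sup>+t. (SUP k. ?f k t) \<partial>lborel)"
    by simp
  also have "\<dots> = (SUP k. \<integral>\<^sup>+t. ?f k t \<partial>lborel)"
  proof (rule nn_integral_monotone_convergence_SUP)
    show "incseq ?f"
    proof (intro incseq_SucI le_funI)
      fix k t
      show "?f k t \<le> ?f (Suc k) t"
        using bound_mono[of k "Suc k"] unfolding indicator_def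
        by (cases "t \<in> {0..<1 - 1 / real (Suc k)}") auto
    qed
    show "?f k \<in> borel_measurable lborel" for k
      by (rule mono_on_measurable_on_subinterval[OF assms]) auto
  qed
  finally show ?thesis .
qed

lemma integral_le_SUP:
  fixes H :: "real \<Rightarrow> real"
  assumes nonneg: "\<And>t. t \<in> {0..<1} \<Longrightarrow> 0 \<le> H t" and mono: "mono_on {0..<1} H"
  shows "ennreal (1 / sqrt 2) * (\<integral>\<^sup>+t\<in>{0..<1}. ennreal (H t) \<partial>lborel)
      \<le> (SUP n\<in>{1::nat..}. ennreal (sqrt (real n)) * A_inf H n)" (is "_ \<le> ?S")
proof -
  have "ennreal (1 / sqrt 2) * (\<integral>\<^sup>+t\<in>{0..<1 - 1 / real (Suc k)}. ennreal (H t) \<partial>lborel) \<le> ?S" for k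
  proof -
    have "ennreal (1 / sqrt 2) * (\<integral>\<^sup>+t\<in>{0..<1 - 1 / real (Suc k)}. ennreal (H t) \<partial>lborel)
        \<le> ennreal (1 / sqrt 2) * ennreal (lower_sum H (Suc k))"
      by (intro mult_left_mono truncated_integral_le_lower_sum[OF nonneg mono]) auto
    also have "\<dots> = ennreal (lower_sum H (Suc k) / sqrt 2)"
      by (subst ennreal_mult'[symmetric]) auto
    also have "\<dots> \<le> ?S" by (rule lower_sum_le_SUP[OF nonneg mono]) auto
    finally show ?thesis .
  qed
  then show ?thesis
    unfolding integral_eq_SUP_truncated[OF mono] SUP_mult_left_ennreal by (rule SUP_least)
qed

theorem theorem2p3:
  fixes H :: "real \<Rightarrow> real"
  assumes "\<And>t. t \<in> {0..<1} \<Longrightarrow> 0 \<le> H t"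
    and "mono_on {0..<1} H"
  shows "((SUP n\<in>{1::nat..}. ennreal (sqrt (real n)) * A_inf H n) < \<infinity>
            \<longleftrightarrow> (\<integral>\<^sup>+t\<in>{0..<1}. ennreal (H t) \<partial>lborel) < \<infinity>)
       \<and> ennreal (1 / sqrt 2) * (\<integral>\<^sup>+t\<in>{0..<1}. ennreal (H t) \<partial>lborel)
            \<le> (SUP n\<in>{1::nat..}. ennreal (sqrt (real n)) * A_inf H n)
       \<and> (SUP n\<in>{1::nat..}. ennreal (sqrt (real n)) * A_inf H n)
            \<le> ennreal (sqrt 2) * (\<integral>\<^sup>+t\<in>{0..<1}. ennreal (H t) \<partial>lborel)"
proof -
  let ?S = "SUP n\<in>{1::nat..}. ennreal (sqrt (real n)) * A_inf H n"
  let ?I = "\<integral>\<^sup>+t\<in>{0..<1}. ennreal (H t) \<partial>lborel"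
  have lower: "ennreal (1 / sqrt 2) * ?I \<le> ?S"
    by (rule integral_le_SUP[OF assms])
  have upper: "?S \<le> ?I"
    by (intro SUP_least scaled_A_inf_le_integral[OF assms]) auto
  also have "?I \<le> ennreal (sqrt 2) * ?I"
    using mult_right_mono[of 1 "ennreal (sqrt 2)" ?I] by simp
  finally have upper': "?S \<le> ennreal (sqrt 2) * ?I" .
  have "?I < \<infinity>" if "?S < \<infinity>"
  proof -
    have "ennreal (1 / sqrt 2) * ?I < \<infinity>" using lower that by (rule le_less_trans)
    then show ?thesis by (auto simp: ennreal_mult_less_top)
  qed
  then show ?thesis
    using lower upper upper' le_less_trans by blast
qed

end
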